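(* Let $n\ge1$, $1\le d\le m-1$ be integers, $\gamma>0$, $\epsilon\ge0$, and let $X,Y$ be non-empty subsets of $E=\mathbb{R}^n\times M(\mathbb{R}^m)$, endowed with the norm $\|\cdot\|_\gamma$, such that $t^{\max}_\gamma(X)>0$ and $t^{\max}_\gamma(Y)>0$. If the Hausdorff distance satisfies $\mathrm{d}_H(X,Y)\le\epsilon$, then there exists an $\epsilon$-interleaving between the persistent cohomology modules of the Čech bundle filtrations of $X$ and of $Y$ which sends persistent Stiefel-Whitney classes to persistent Stiefel-Whitney classes. That is, with $T=[0,t^{\max}_\gamma(X))$ and $U=[0,t^{\max}_\gamma(Y))$, there is an $\epsilon$-interleaving $(\phi,\psi)$, with $\phi^t\colon H^*(Y^t)\to H^*(X^{t-\epsilon})$ for $t\in(T+\epsilon)\cap U$ and $\psi^s\colon H^*(X^s)\to H^*(Y^{s-\epsilon})$ for $s\in(U+\epsilon)\cap T$, such that for every $i\in\{1,\dots,d\}$ and all such $t,s$: $\phi^t(w_i^t(Y))=w_i^{t-\epsilon}(X)$ and $\psi^s(w_i^s(X))=w_i^{s-\epsilon}(Y)$.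
   Context: $H^*$ is singular cohomology with $\mathbb{Z}/2$ coefficients. $M(\mathbb{R}^m)$ is the space of real $m\times m$ matrices with Frobenius norm $\|\cdot\|_F$; $E=\mathbb{R}^n\times M(\mathbb{R}^m)$ carries the Euclidean norm $\|(x,A)\|_\gamma^2=\|x\|^2+\gamma^2\|A\|_F^2$, and the Hausdorff distance is taken for this norm. The Grassmannian $\mathcal{G}_d(\mathbb{R}^m)$ is identified with the set of rank-$d$ orthogonal projection matrices in $M(\mathbb{R}^m)$. Its medial axis $\mathrm{med}(\mathcal{G}_d(\mathbb{R}^m))$ is the set of matrices having at least two distinct nearest points (for $\|\cdot\|_F$) in $\mathcal{G}_d(\mathbb{R}^m)$; outside it, $\mathrm{proj}(\cdot,\mathcal{G}_d(\mathbb{R}^m))$ denotes the nearest-point projection. For $X\subset E$ and $t\ge0$, the $t$-thickening is $X^t=\{e\in E:\ \inf_{x\in X}\|e-x\|_\gamma\le t\}$. Set $t^{\max}_\gamma(X)=\gamma\cdot\inf\{\mathrm{dist}(A,\mathrm{med}(\mathcal{G}_d(\mathbb{R}^m))):\ (y,A)\in X\}$, where $\mathrm{dist}$ is the Frobenius distance. When $t^{\max}_\gamma(X)>0$, the Čech bundle filtration of $X$ (of dimension $d$) is the filtration $(X^t)_{t\in T}$, $T=[0,t^{\max}_\gamma(X))$, with the continuous maps $p^t\colon X^t\to\mathcal{G}_d(\mathbb{R}^m)$, $p^t(x,A)=\mathrm{proj}(A,\mathcal{G}_d(\mathbb{R}^m))$. Its $i$-th persistent Stiefel-Whitney class is $w_i(X)=(w_i^t(X))_{t\in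 T}$, $w_i^t(X)=(p^t)^*(w_i)\in H^i(X^t)$, where $w_i\in H^i(\mathcal{G}_d(\mathbb{R}^m))$ is the $i$-th Stiefel-Whitney class of the tautological bundle of $\mathcal{G}_d(\mathbb{R}^m)$. Its persistent cohomology module is the family $(H^*(X^t))_{t\in T}$ with restriction maps $H^*(X^t)\to H^*(X^s)$, $s\le t$. An $\epsilon$-interleaving between the modules of $X$ (index set $T$) and $Y$ (index set $U$) is a pair of families of linear maps $\phi^t\colon H^*(Y^t)\to H^*(X^{t-\epsilon})$ ($t\in(T+\epsilon)\cap U$), $\psi^s\colon H^*(X^s)\to H^*(Y^{s-\epsilon})$ ($s\in(U+\epsilon)\cap T$), commuting with the restriction maps of the two modules, such that, whenever the maps are defined, $\phi^{t-\epsilon}\circ\psi^t\colon H^*(X^t)\to H^*(X^{t-2\epsilon})$ and $\psi^{t-\epsilon}\circ\phi^t\colon H^*(Y^t)\to H^*(Y^{t-2\epsilon})$ are the restriction maps. *)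

theory Defs
  imports "HOL-Analysis.Analysis" "HOL-Homology.Homology" "HOL-Library.Z2"
begin

section \<open>Singular cohomology with coefficients in Z/2\<close>

text \<open>
  A cochain assigns an element of Z/2 to every singular simplex, and takes the value 0 on every
  function that is not a singular simplex of the space. As in HOL-Homology, the groups are written
  multiplicatively as HOL-Algebra structures. A vector space over Z/2 is an abelian group in which
  every element is its own inverse, and the Z/2-linear maps are exactly the group homomorphisms.
\<close>

type_synonym 'a cochain = "((nat \<Rightarrow> real) \<Rightarrow> 'a) \<Rightarrow> bit"

definition cochain_set :: "nat \<Rightarrow> 'a topology \<Rightarrow> 'a cochain set" where
  "cochain_set p X = {c. \<forall>\<sigma>. \<not> singular_simplex p X \<sigma> \<longrightarrow> c \<sigma> = 0}"

text \<open>The signs of the boundary formula disappear modulo 2.\<close>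

definition coboundary :: "nat \<Rightarrow> 'a topology \<Rightarrow> 'a cochain \<Rightarrow> 'a cochain" where
  "coboundary p X c =
     (\<lambda>\<sigma>. if singular_simplex (Suc p) X \<sigma> then \<Sum>k\<le>Suc p. c (singular_face (Suc p) k \<sigma>) else 0)"

definition cocycle_set :: "nat \<Rightarrow> 'a topology \<Rightarrow> 'a cochain set" where
  "cocycle_set p X = {c \<in> cochain_set p X. coboundary p X c = (\<lambda>\<sigma>. 0)}"

fun coboundary_set :: "nat \<Rightarrow> 'a topology \<Rightarrow> 'a cochain set" where
  "coboundary_set 0 X = {\<lambda>\<sigma>. 0}"
| "coboundary_set (Suc p) X = coboundary p X ` cochain_set p X"

definition cocycle_group :: "nat \<Rightarrow> 'a topology \<Rightarrow> 'a cochain monoid" where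
  "cocycle_group p X =
     \<lparr>carrier = cocycle_set p X, monoid.mult = (\<lambda>c c' \<sigma>. c \<sigma> + c' \<sigma>), one = (\<lambda>\<sigma>. 0)\<rparr>"

definition cohomology_group :: "nat \<Rightarrow> 'a topology \<Rightarrow> 'a cochain set monoid" where
  "cohomology_group p X = cocycle_group p X Mod coboundary_set p X"

definition cohomology_class :: "nat \<Rightarrow> 'a topology \<Rightarrow> 'a cochain \<Rightarrow> 'a cochain set" where
  "cohomology_class p X c = coboundary_set p X #>\<^bsub>cocycle_group p X\<^esub> c"

definition cochain_pullback ::
  "nat \<Rightarrow> 'a topology \<Rightarrow> ('a \<Rightarrow> 'b) \<Rightarrow> 'b cochain \<Rightarrow> 'a cochain" where
  "cochain_pullback p X f c = (\<lambda>\<sigma>. if singular_simplex p X \<sigma> then c (simplex_map p f \<sigma>) else 0)"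

text \<open>
  For a continuous map \<open>f\<close> from \<open>X\<close> to \<open>Y\<close>, all the classes in the union below coincide, so that the
  union is the class of the pullback of any representative.
\<close>

definition cohomology_pullback ::
  "nat \<Rightarrow> 'a topology \<Rightarrow> ('a \<Rightarrow> 'b) \<Rightarrow> 'b cochain set \<Rightarrow> 'a cochain set" where
  "cohomology_pullback p X f K = (\<Union>c\<in>K. cohomology_class p X (cochain_pullback p X f c))"

definition unit_class :: "'a topology \<Rightarrow> 'a cochain set" where
  "unit_class X = cohomology_class 0 X (\<lambda>\<sigma>. if singular_simplex 0 X \<sigma> then 1 else 0)"

text \<open>The cup product: evaluate on the front p-face and on the back q-face.\<close>

definition cochain_cup ::
  "nat \<Rightarrow> nat \<Rightarrow> 'a topology \<Rightarrow> 'a cochain \<Rightarrow> 'a cochain \<Rightarrow> 'a cochain" where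
  "cochain_cup p q X c c' =
     (\<lambda>\<sigma>. if singular_simplex (p + q) X \<sigma>
          then c (restrict \<sigma> (standard_simplex p)) *
               c' (restrict (\<lambda>x. \<sigma> (\<lambda>i. if i < p then 0 else x (i - p))) (standard_simplex q))
          else 0)"

definition cohomology_cup ::
  "nat \<Rightarrow> nat \<Rightarrow> 'a topology \<Rightarrow> 'a cochain set \<Rightarrow> 'a cochain set \<Rightarrow> 'a cochain set" where
  "cohomology_cup p q X K L =
     (\<Union>c\<in>K. \<Union>c'\<in>L. cohomology_class (p + q) X (cochain_cup p q X c c'))"

text \<open>The total cohomology is the direct sum of the groups in the single degrees.\<close>

definition total_cohomology :: "'a topology \<Rightarrow> (nat \<Rightarrow> 'a cochain set) monoid" where
  "total_cohomology X = sum_group UNIV (\<lambda>i. cohomology_group i X)"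

definition total_pullback ::
  "'a topology \<Rightarrow> ('a \<Rightarrow> 'b) \<Rightarrow> (nat \<Rightarrow> 'b cochain set) \<Rightarrow> (nat \<Rightarrow> 'a cochain set)" where
  "total_pullback X f h = (\<lambda>i. cohomology_pullback i X f (h i))"

definition in_degree :: "nat \<Rightarrow> 'a topology \<Rightarrow> 'a cochain set \<Rightarrow> (nat \<Rightarrow> 'a cochain set)" where
  "in_degree i X K = (\<lambda>j. if j = i then K else \<one>\<^bsub>cohomology_group j X\<^esub>)"


section \<open>Real vector bundles\<close>

record ('b, 'e) vector_bundle =
  bundle_base :: "'b topology"
  bundle_total :: "'e topology"
  bundle_proj :: "'e \<Rightarrow> 'b"
  fibre_add :: "'e \<Rightarrow> 'e \<Rightarrow> 'e"
  fibre_scale :: "real \<Rightarrow> 'e \<Rightarrow> 'e"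
  bundle_rank :: nat

definition bundle_fibre :: "('b, 'e) vector_bundle \<Rightarrow> 'b \<Rightarrow> 'e set" where
  "bundle_fibre \<xi> b = {e \<in> topspace (bundle_total \<xi>). bundle_proj \<xi> e = b}"

text \<open>
  A local trivialization is a homeomorphism onto the part of the total space over U that is
  fibrewise linear; the vector space laws on the fibres are therefore inherited from
  \<^term>\<open>Euclidean_space\<close>. The values of the operations outside the fibres are irrelevant.
\<close>

definition local_trivialization ::
  "('b, 'e) vector_bundle \<Rightarrow> 'b set \<Rightarrow> ('b \<times> (nat \<Rightarrow> real) \<Rightarrow> 'e) \<Rightarrow> bool" where
  "local_trivialization \<xi> U h \<longleftrightarrow>
     homeomorphic_map
       (prod_topology (subtopology (bundle_base \<xi>) U) (Euclidean_space (bundle_rank \<xi>)))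
       (subtopology (bundle_total \<xi>) {e \<in> topspace (bundle_total \<xi>). bundle_proj \<xi> e \<in> U}) h \<and>
     (\<forall>b\<in>U. \<forall>v \<in> topspace (Euclidean_space (bundle_rank \<xi>)).
        bundle_proj \<xi> (h (b, v)) = b \<and>
        (\<forall>v' \<in> topspace (Euclidean_space (bundle_rank \<xi>)).
           h (b, \<lambda>i. v i + v' i) = fibre_add \<xi> (h (b, v)) (h (b, v'))) \<and>
        (\<forall>r. h (b, \<lambda>i. r * v i) = fibre_scale \<xi> r (h (b, v))))"

definition vector_bundle :: "('b, 'e) vector_bundle \<Rightarrow> bool" where
  "vector_bundle \<xi> \<longleftrightarrow>
     continuous_map (bundle_total \<xi>) (bundle_base \<xi>) (bundle_proj \<xi>) \<and>
     (\<forall>b \<in> topspace (bundle_base \<xi>).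
        \<exists>U h. openin (bundle_base \<xi>) U \<and> b \<in> U \<and> local_trivialization \<xi> U h)"

text \<open>A bundle map g over f carries each fibre isomorphically onto a fibre.\<close>

definition bundle_map ::
  "('b, 'e) vector_bundle \<Rightarrow> ('c, 'f) vector_bundle \<Rightarrow> ('e \<Rightarrow> 'f) \<Rightarrow> ('b \<Rightarrow> 'c) \<Rightarrow> bool" where
  "bundle_map \<xi> \<eta> g f \<longleftrightarrow>
     continuous_map (bundle_total \<xi>) (bundle_total \<eta>) g \<and>
     continuous_map (bundle_base \<xi>) (bundle_base \<eta>) f \<and>
     (\<forall>b \<in> topspace (bundle_base \<xi>).
        bij_betw g (bundle_fibre \<xi> b) (bundle_fibre \<eta> (f b)) \<and>
        (\<forall>e \<in> bundle_fibre \<xi> b.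
           (\<forall>e' \<in> bundle_fibre \<xi> b. g (fibre_add \<xi> e e') = fibre_add \<eta> (g e) (g e')) \<and>
           (\<forall>r. g (fibre_scale \<xi> r e) = fibre_scale \<eta> r (g e))))"

definition whitney_sum ::
  "('b, 'e) vector_bundle \<Rightarrow> ('b, 'f) vector_bundle \<Rightarrow> ('b, 'e \<times> 'f) vector_bundle" where
  "whitney_sum \<xi> \<eta> =
     \<lparr>bundle_base = bundle_base \<xi>,
      bundle_total = subtopology (prod_topology (bundle_total \<xi>) (bundle_total \<eta>))
                       {(e, e'). bundle_proj \<xi> e = bundle_proj \<eta> e'},
      bundle_proj = (\<lambda>(e, e'). bundle_proj \<xi> e),
      fibre_add = (\<lambda>(e1, e1') (e2, e2'). (fibre_add \<xi> e1 e2, fibre_add \<eta> e1' e2')),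
      fibre_scale = (\<lambda>r (e, e'). (fibre_scale \<xi> r e, fibre_scale \<eta> r e')),
      bundle_rank = bundle_rank \<xi> + bundle_rank \<eta>\<rparr>"


section \<open>Grassmannians and Stiefel-Whitney classes\<close>

definition grassmannian :: "nat \<Rightarrow> (real^'m^'m) set" where
  "grassmannian d = {P. transpose P = P \<and> P ** P = P \<and> rank P = d}"

definition tautological_bundle :: "nat \<Rightarrow> (real^'m^'m, (real^'m^'m) \<times> (real^'m)) vector_bundle" where
  "tautological_bundle d =
     \<lparr>bundle_base = top_of_set (grassmannian d),
      bundle_total = top_of_set {(P, v). P \<in> grassmannian d \<and> v \<in> range ((*v) P)},
      bundle_proj = fst,
      fibre_add = (\<lambda>(P, v) (Q, v'). (P, v + v')),
      fibre_scale = (\<lambda>r (P, v). (P, r *\<^sub>R v)),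
      bundle_rank = d\<rparr>"

text \<open>
  The axioms characterizing Stiefel-Whitney classes: membership, rank, naturality, Whitney sum
  formula, and nontriviality on the tautological line bundle over the projective line, which is
  the Grassmannian of lines in the plane.

  The assignment w is defined on the vector bundles whose base is an arbitrary topological space
  carried by a set of elements of one type, and whose total space is likewise carried by a second
  type. If both types have the cardinality of the continuum, every bundle whose base and total space
  have at most that cardinality is isomorphic to one of these. This includes all bundles
  over compact manifolds, hence those used in the classical argument that the axioms determine the
  classes of the tautological bundles over Grassmannians (products of projective spaces and
  Grassmannians, with sums of line bundles). Since a Whitney sum, or the tautological bundle over
  the projective line, is carried by other types, the last two axioms speak about all bundles
  isomorphic to it.
\<close>

definition stiefel_whitney_classes ::
  "(('b, 'e) vector_bundle \<Rightarrow> nat \<Rightarrow> 'b cochain set) \<Rightarrow> bool" where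
  "stiefel_whitney_classes w \<longleftrightarrow>
     (\<forall>\<xi> i. vector_bundle \<xi> \<longrightarrow> w \<xi> i \<in> carrier (cohomology_group i (bundle_base \<xi>))) \<and>
     (\<forall>\<xi>. vector_bundle \<xi> \<longrightarrow>
        w \<xi> 0 = unit_class (bundle_base \<xi>) \<and>
        (\<forall>i > bundle_rank \<xi>. w \<xi> i = \<one>\<^bsub>cohomology_group i (bundle_base \<xi>)\<^esub>)) \<and>
     (\<forall>\<xi> \<eta> g f. vector_bundle \<xi> \<and> vector_bundle \<eta> \<and> bundle_map \<xi> \<eta> g f \<longrightarrow>
        (\<forall>i. w \<xi> i = cohomology_pullback i (bundle_base \<xi>) f (w \<eta> i))) \<and>
     (\<forall>\<xi> \<eta> \<zeta> g. vector_bundle \<xi> \<and> vector_bundle \<eta> \<and> vector_bundle \<zeta> \<and>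
        bundle_base \<xi> = bundle_base \<eta> \<and> bundle_base \<zeta> = bundle_base \<xi> \<and>
        bundle_rank \<zeta> = bundle_rank \<xi> + bundle_rank \<eta> \<and>
        bundle_map \<zeta> (whitney_sum \<xi> \<eta>) g id \<longrightarrow>
        (\<forall>k. w \<zeta> k = finprod (cohomology_group k (bundle_base \<xi>))
                (\<lambda>i. cohomology_cup i (k - i) (bundle_base \<xi>) (w \<xi> i) (w \<eta> (k - i))) {..k})) \<and>
     (\<forall>\<zeta> g f. vector_bundle \<zeta> \<and> bundle_rank \<zeta> = 1 \<and>
        bundle_map \<zeta> (tautological_bundle 1 :: (real^2^2, (real^2^2) \<times> (real^2)) vector_bundle) g f \<and>
        homeomorphic_map (bundle_base \<zeta>) (top_of_set (grassmannian 1 :: (real^2^2) set)) f \<longrightarrow>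
        w \<zeta> 1 \<noteq> \<one>\<^bsub>cohomology_group 1 (bundle_base \<zeta>)\<^esub>)"


section \<open>Cech bundle filtrations\<close>

text \<open>The library norm and distance on \<^typ>\<open>real^'m^'m\<close> are those of Frobenius.\<close>

definition gamma_norm :: "real \<Rightarrow> (real^'n) \<times> (real^'m^'m) \<Rightarrow> real" where
  "gamma_norm \<gamma> = (\<lambda>(x, A). sqrt ((norm x)\<^sup>2 + \<gamma>\<^sup>2 * (norm A)\<^sup>2))"

text \<open>The Hausdorff distance of unbounded sets may be infinite.\<close>

definition hausdorff_distance ::
  "real \<Rightarrow> ((real^'n) \<times> (real^'m^'m)) set \<Rightarrow> ((real^'n) \<times> (real^'m^'m)) set \<Rightarrow> ennreal" where
  "hausdorff_distance \<gamma> X Y =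
     max (SUP x\<in>X. INF y\<in>Y. ennreal (gamma_norm \<gamma> (x - y)))
         (SUP y\<in>Y. INF x\<in>X. ennreal (gamma_norm \<gamma> (x - y)))"

definition thickening ::
  "real \<Rightarrow> ((real^'n) \<times> (real^'m^'m)) set \<Rightarrow> real \<Rightarrow> ((real^'n) \<times> (real^'m^'m)) set" where
  "thickening \<gamma> X t = {e. (INF x\<in>X. gamma_norm \<gamma> (e - x)) \<le> t}"

definition medial_axis :: "'a::metric_space set \<Rightarrow> 'a set" where
  "medial_axis S = {a. \<exists>p\<in>S. \<exists>q\<in>S. p \<noteq> q \<and>
     (\<forall>s\<in>S. dist a p \<le> dist a s) \<and> (\<forall>s\<in>S. dist a q \<le> dist a s)}"

text \<open>
  For \<open>1 \<le> d < m\<close> the medial axis contains the zero matrix, so that \<^const>\<open>infdist\<close> is a genuine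
  distance.
\<close>

definition t_max :: "real \<Rightarrow> nat \<Rightarrow> ((real^'n) \<times> (real^'m^'m)) set \<Rightarrow> real" where
  "t_max \<gamma> d X = \<gamma> * (INF (y, A)\<in>X. infdist A (medial_axis (grassmannian d)))"

definition cech_index :: "real \<Rightarrow> nat \<Rightarrow> ((real^'n) \<times> (real^'m^'m)) set \<Rightarrow> real set" where
  "cech_index \<gamma> d X = {0..<t_max \<gamma> d X}"

text \<open>
  All the norms \<^const>\<open>gamma_norm\<close> with \<open>\<gamma> > 0\<close> induce the usual topology of the product.
\<close>

definition cech_space ::
  "real \<Rightarrow> ((real^'n) \<times> (real^'m^'m)) set \<Rightarrow> real \<Rightarrow> ((real^'n) \<times> (real^'m^'m)) topology" where
  "cech_space \<gamma> X t = top_of_set (thickening \<gamma> X t)"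

definition cech_map :: "nat \<Rightarrow> (real^'n) \<times> (real^'m^'m) \<Rightarrow> real^'m^'m" where
  "cech_map d = (\<lambda>(x, A). closest_point (grassmannian d) A)"

definition cech_cohomology ::
  "real \<Rightarrow> ((real^'n) \<times> (real^'m^'m)) set \<Rightarrow> real \<Rightarrow>
    (nat \<Rightarrow> ((real^'n) \<times> (real^'m^'m)) cochain set) monoid" where
  "cech_cohomology \<gamma> X t = total_cohomology (cech_space \<gamma> X t)"

text \<open>\<open>cech_restriction \<gamma> X s t\<close> goes from index t to the smaller index s.\<close>

definition cech_restriction ::
  "real \<Rightarrow> ((real^'n) \<times> (real^'m^'m)) set \<Rightarrow> real \<Rightarrow> real \<Rightarrow>
    (nat \<Rightarrow> ((real^'n) \<times> (real^'m^'m)) cochain set) \<Rightarrow>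
    (nat \<Rightarrow> ((real^'n) \<times> (real^'m^'m)) cochain set)" where
  "cech_restriction \<gamma> X s t = total_pullback (cech_space \<gamma> X s) id"

definition persistent_stiefel_whitney ::
  "((real^'m^'m, (real^'m^'m) \<times> (real^'m)) vector_bundle \<Rightarrow> nat \<Rightarrow> (real^'m^'m) cochain set) \<Rightarrow>
    real \<Rightarrow> nat \<Rightarrow> ((real^'n) \<times> (real^'m^'m)) set \<Rightarrow> nat \<Rightarrow> real \<Rightarrow>
    (nat \<Rightarrow> ((real^'n) \<times> (real^'m^'m)) cochain set)" where
  "persistent_stiefel_whitney w \<gamma> d X i t =
     in_degree i (cech_space \<gamma> X t)
       (cohomology_pullback i (cech_space \<gamma> X t) (cech_map d) (w (tautological_bundle d) i))"


section \<open>Interleavings\<close>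

text \<open>
  The modules \<open>V\<close> and \<open>W\<close> are indexed by \<open>T\<close> and \<open>U\<close> and contravariant: for \<open>s \<le> t\<close>,
  \<open>v s t\<close> goes from \<open>V t\<close> to \<open>V s\<close>.
\<close>

definition interleaving ::
  "real \<Rightarrow> real set \<Rightarrow> (real \<Rightarrow> 'g monoid) \<Rightarrow> (real \<Rightarrow> real \<Rightarrow> 'g \<Rightarrow> 'g) \<Rightarrow>
    real set \<Rightarrow> (real \<Rightarrow> 'h monoid) \<Rightarrow> (real \<Rightarrow> real \<Rightarrow> 'h \<Rightarrow> 'h) \<Rightarrow>
    (real \<Rightarrow> 'h \<Rightarrow> 'g) \<Rightarrow> (real \<Rightarrow> 'g \<Rightarrow> 'h) \<Rightarrow> bool" where
  "interleaving \<epsilon> T V v U W w \<phi> \<psi> \<longleftrightarrow>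
     (let I = (\<lambda>t. t + \<epsilon>) ` T \<inter> U; J = (\<lambda>t. t + \<epsilon>) ` U \<inter> T in
       (\<forall>t\<in>I. \<phi> t \<in> hom (W t) (V (t - \<epsilon>))) \<and>
       (\<forall>t\<in>J. \<psi> t \<in> hom (V t) (W (t - \<epsilon>))) \<and>
       (\<forall>s\<in>I. \<forall>t\<in>I. s \<le> t \<longrightarrow>
          (\<forall>x \<in> carrier (W t). \<phi> s (w s t x) = v (s - \<epsilon>) (t - \<epsilon>) (\<phi> t x))) \<and>
       (\<forall>s\<in>J. \<forall>t\<in>J. s \<le> t \<longrightarrow>
          (\<forall>x \<in> carrier (V t). \<psi> s (v s t x) = w (s - \<epsilon>) (t - \<epsilon>) (\<psi> t x))) \<and>
       (\<forall>t\<in>J. t - \<epsilon> \<in> I \<longrightarrow>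
          (\<forall>x \<in> carrier (V t). \<phi> (t - \<epsilon>) (\<psi> t x) = v (t - 2 * \<epsilon>) t x)) \<and>
       (\<forall>t\<in>I. t - \<epsilon> \<in> J \<longrightarrow>
          (\<forall>x \<in> carrier (W t). \<psi> (t - \<epsilon>) (\<phi> t x) = w (t - 2 * \<epsilon>) t x)))"

end

theory Submission
  imports Defs
begin

text \<open>
  If the Hausdorff distance of \<open>X\<close> and \<open>Y\<close> is at most \<open>\<epsilon>\<close>, the triangle inequality shows that each
  thickening of one of the two sets is contained in the thickening of the other with \<open>\<epsilon>\<close> added to
  the index. The interleaving consists of the maps induced by these inclusions. All maps between
  thickenings are inclusions and the maps to the Grassmannian are restrictions of the same function,
  so that every required identity is an instance of the functoriality of the pullback.
\<close>

text \<open>Sums of bits stay written with \<open>+\<close>, so that the laws of abelian groups and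
  of finite sums apply to the values of cochains.\<close>

declare add_bit_eq_xor [simp del]

text \<open>Characteristic 2: this cancels matching faces in a double coboundary and makes every
  cocycle its own inverse.\<close>

lemma bit_add_self [simp]: "x + x = 0" for x :: bit
  by (cases x) simp_all

section \<open>Cohomology groups\<close>

lemma singular_simplex_face:
  assumes "singular_simplex (Suc p) X \<sigma>" and "k \<le> Suc p"
  shows "singular_simplex p X (singular_face (Suc p) k \<sigma>)"
  using singular_simplex_singular_face [OF assms(1) _ assms(2)] by simp

text \<open>Inserting a zero coordinate at i and then at j + 1 amounts to inserting one at j and
  then at i, since the later insertion shifts the earlier zero. The form with \<open>Suc j\<close>
  and i \<le> j avoids a predecessor.\<close>

lemma singular_face_singular_face:
  assumes "i \<le> j" and "j \<le> Suc p"
  shows "singular_face (Suc p) i (singular_face (Suc (Suc p)) (Suc j) \<sigma>) =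
         singular_face (Suc p) j (singular_face (Suc (Suc p)) i \<sigma>)"
proof
  fix t
  show "singular_face (Suc p) i (singular_face (Suc (Suc p)) (Suc j) \<sigma>) t =
        singular_face (Suc p) j (singular_face (Suc (Suc p)) i \<sigma>) t"
  proof (cases "t \<in> standard_simplex p")
    case True
    have "simplical_face i t \<in> standard_simplex (Suc p)" "simplical_face j t \<in> standard_simplex (Suc p)"
      using simplical_face_in_standard_simplex [of "Suc p" _ t] True assms by auto
    moreover have "simplical_face (Suc j) (simplical_face i t) = simplical_face i (simplical_face j t)"
      using True assms unfolding standard_simplex_def simplical_face_def by fastforce
    ultimately show ?thesis
      by (simp add: singular_face_def)
  qed (simp add: singular_face_def)
qed

text \<open>The double sum runs over pairs of face indices (k, j). By the simplicial identity the
  pairs with j < k and those with k \<le> j have the same sum, and the two sums cancel modulo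
  2.\<close>

lemma coboundary_coboundary: "coboundary (Suc p) X (coboundary p X c) = (\<lambda>\<sigma>. 0)"
proof
  fix \<sigma>
  show "coboundary (Suc p) X (coboundary p X c) \<sigma> = 0"
  proof (cases "singular_simplex (Suc (Suc p)) X \<sigma>")
    case True
    define F where
      "F = (\<lambda>(k, j). c (singular_face (Suc p) j (singular_face (Suc (Suc p)) k \<sigma>)))"
    define L where "L = {(k, j). k \<le> Suc (Suc p) \<and> j < k}"
    define U where "U = {(k, j). j \<le> Suc p \<and> k \<le> j}"
    have split: "{..Suc (Suc p)} \<times> {..Suc p} = L \<union> U" "L \<inter> U = {}"
      by (auto simp: L_def U_def)
    then have fin: "finite L" "finite U"
      by (metis finite_SigmaI finite_atMost finite_Un)+
    \<comment> \<open>The pair (k, j) in \<open>L\<close> corresponds to (j, k - 1) in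
      \<open>U\<close>; j < k forces k > 0, so the truncated subtraction is exact.\<close>
    have "sum F L = sum F U"
      by (rule sum.reindex_bij_witness [where j = "\<lambda>(k, j). (j, k - 1)" and i = "\<lambda>(i, j). (Suc j, i)"])
        (auto simp: L_def U_def F_def singular_face_singular_face [symmetric] Suc_diff_Suc)
    then have "sum F ({..Suc (Suc p)} \<times> {..Suc p}) = 0"
      by (simp add: split sum.union_disjoint fin)
    moreover have "coboundary (Suc p) X (coboundary p X c) \<sigma> =
        (\<Sum>k\<le>Suc (Suc p). \<Sum>j\<le>Suc p. F (k, j))"
      using True by (auto simp: coboundary_def F_def intro!: sum.cong dest: singular_simplex_face
          simp del: sum.atMost_Suc)
    ultimately show ?thesis
      by (simp add: sum.cartesian_product del: sum.atMost_Suc)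
  qed (simp add: coboundary_def)
qed

section \<open>Groups of cocycles and coboundaries\<close>

lemma coboundary_zero [simp]: "coboundary p X (\<lambda>\<sigma>. 0) = (\<lambda>\<sigma>. 0)"
  by (simp add: coboundary_def fun_eq_iff)

lemma coboundary_add:
  "coboundary p X (\<lambda>\<sigma>. c \<sigma> + c' \<sigma>) = (\<lambda>\<sigma>. coboundary p X c \<sigma> + coboundary p X c' \<sigma>)"
  by (auto simp: coboundary_def fun_eq_iff sum.distrib simp del: sum.atMost_Suc)

lemma cocycle_set_zero: "(\<lambda>\<sigma>. 0) \<in> cocycle_set p X"
  by (simp add: cocycle_set_def cochain_set_def)

lemma cocycle_set_add:
  "\<lbrakk>c \<in> cocycle_set p X; c' \<in> cocycle_set p X\<rbrakk> \<Longrightarrow> (\<lambda>\<sigma>. c \<sigma> + c' \<sigma>) \<in> cocycle_set p X"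
  by (simp add: cocycle_set_def cochain_set_def coboundary_add)

lemma coboundary_set_zero: "(\<lambda>\<sigma>. 0) \<in> coboundary_set p X"
  by (cases p) (auto simp: cochain_set_def intro!: image_eqI [where x = "\<lambda>\<sigma>. 0"])

lemma coboundary_set_add:
  assumes "b \<in> coboundary_set p X" "b' \<in> coboundary_set p X"
  shows "(\<lambda>\<sigma>. b \<sigma> + b' \<sigma>) \<in> coboundary_set p X"
proof (cases p)
  case (Suc q)
  then obtain c c' where "c \<in> cochain_set q X" "c' \<in> cochain_set q X"
    "b = coboundary q X c" "b' = coboundary q X c'"
    using assms by auto
  then show ?thesis
    by (auto simp: Suc cochain_set_def simp flip: coboundary_add intro!: imageI)
qed (use assms in simp)

lemma coboundary_set_subset: "coboundary_set p X \<subseteq> cocycle_set p X"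
proof (cases p)
  case (Suc q)
  then show ?thesis
    by (auto simp: cocycle_set_def cochain_set_def coboundary_coboundary)
      (simp add: coboundary_def)
qed (simp add: cocycle_set_zero)

lemma comm_group_cocycle_group: "comm_group (cocycle_group p X)"
proof (rule comm_groupI)
  fix c
  assume "c \<in> carrier (cocycle_group p X)"
  then show "\<exists>c'\<in>carrier (cocycle_group p X).
      c' \<otimes>\<^bsub>cocycle_group p X\<^esub> c = \<one>\<^bsub>cocycle_group p X\<^esub>"
    by (auto simp: cocycle_group_def intro!: bexI [where x = c])
qed (auto simp: cocycle_group_def cocycle_set_add cocycle_set_zero algebra_simps)

lemma inv_cocycle_group:
  "c \<in> cocycle_set p X \<Longrightarrow> inv\<^bsub>cocycle_group p X\<^esub> c = c"
  by (rule group.inv_equality [OF comm_group.axioms(2) [OF comm_group_cocycle_group]])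
    (auto simp: cocycle_group_def)

text \<open>Every subgroup of an abelian group is normal; this is what makes the quotient by the
  coboundaries a group.\<close>

lemma normal_coboundary_set: "coboundary_set p X \<lhd> cocycle_group p X"
proof -
  interpret comm_group "cocycle_group p X"
    by (rule comm_group_cocycle_group)
  have "subgroup (coboundary_set p X) (cocycle_group p X)"
  proof
    fix b
    assume "b \<in> coboundary_set p X"
    then show "inv\<^bsub>cocycle_group p X\<^esub> b \<in> coboundary_set p X"
      using coboundary_set_subset inv_cocycle_group by (metis subsetD)
  qed (use coboundary_set_subset in
      \<open>auto simp: cocycle_group_def coboundary_set_add coboundary_set_zero\<close>)
  then show ?thesis
    by (rule normal_iff_subgroup [THEN iffD2])
qed

section \<open>Cohomology classes and their representatives\<close>

lemma group_cohomology_group: "group (cohomology_group p X)"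
  unfolding cohomology_group_def
  by (rule normal.factorgroup_is_group [OF normal_coboundary_set])

lemma one_cohomology_group: "\<one>\<^bsub>cohomology_group p X\<^esub> = coboundary_set p X"
  by (simp add: cohomology_group_def)

lemma carrier_cohomology_group:
  "carrier (cohomology_group p X) = cohomology_class p X ` cocycle_set p X"
  by (auto simp: cohomology_group_def FactGroup_def RCOSETS_def cohomology_class_def cocycle_group_def)

lemma mult_cohomology_class:
  assumes "c \<in> cocycle_set p X" "c' \<in> cocycle_set p X"
  shows "cohomology_class p X c \<otimes>\<^bsub>cohomology_group p X\<^esub> cohomology_class p X c' =
         cohomology_class p X (\<lambda>\<sigma>. c \<sigma> + c' \<sigma>)"
  using normal.rcos_sum [OF normal_coboundary_set, of c p X c'] assms
  by (simp add: cohomology_group_def cohomology_class_def cocycle_group_def)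

lemma mem_cohomology_class:
  "a \<in> cohomology_class p X c \<longleftrightarrow> (\<exists>b\<in>coboundary_set p X. a = (\<lambda>\<sigma>. b \<sigma> + c \<sigma>))"
  by (auto simp: cohomology_class_def r_coset_def cocycle_group_def)

lemma cohomology_class_zero: "cohomology_class p X (\<lambda>\<sigma>. 0) = coboundary_set p X"
  by (auto simp: mem_cohomology_class)

lemma cohomology_class_add_coboundary:
  assumes b: "b \<in> coboundary_set p X"
  shows "cohomology_class p X (\<lambda>\<sigma>. b \<sigma> + c \<sigma>) = cohomology_class p X c"
proof -
  have sub: "cohomology_class p X (\<lambda>\<sigma>. b \<sigma> + c' \<sigma>) \<subseteq> cohomology_class p X c'" for c'
    using coboundary_set_add [OF _ b]
    by (fastforce simp: mem_cohomology_class add.assoc)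
  \<comment> \<open>Adding b twice changes nothing modulo 2, so \<open>sub\<close> applied to b + c
    is the converse inclusion.\<close>
  have "(\<lambda>\<sigma>. b \<sigma> + (b \<sigma> + c \<sigma>)) = c"
    by (simp flip: add.assoc)
  then show ?thesis
    using sub [of c] sub [of "\<lambda>\<sigma>. b \<sigma> + c \<sigma>"] by auto
qed

section \<open>Pullbacks\<close>

lemma cochain_pullback_zero [simp]: "cochain_pullback p X f (\<lambda>\<sigma>. 0) = (\<lambda>\<sigma>. 0)"
  by (simp add: cochain_pullback_def fun_eq_iff)

lemma cochain_pullback_add:
  "cochain_pullback p X f (\<lambda>\<sigma>. c \<sigma> + c' \<sigma>) =
   (\<lambda>\<sigma>. cochain_pullback p X f c \<sigma> + cochain_pullback p X f c' \<sigma>)"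
  by (auto simp: cochain_pullback_def)

lemma cochain_pullback_mem: "cochain_pullback p X f c \<in> cochain_set p X"
  by (simp add: cochain_pullback_def cochain_set_def)

text \<open>Continuity of f sends singular simplices of X to singular simplices of Y, so on them the
  inner pullback does not fall back to its default value 0.\<close>

lemma cochain_pullback_compose:
  assumes "continuous_map X Y f"
  shows "cochain_pullback p X f (cochain_pullback p Y g c) = cochain_pullback p X (g \<circ> f) c"
  using singular_simplex_simplex_map [OF _ assms]
  by (auto simp: cochain_pullback_def simplex_map_compose)

lemma singular_face_simplex_map_eq:
  assumes "singular_simplex (Suc p) X \<sigma>" and "k \<le> Suc p"
  shows "singular_face (Suc p) k (simplex_map (Suc p) f \<sigma>) =
         simplex_map p f (singular_face (Suc p) k \<sigma>)"
  using assms simplical_face_in_standard_simplex [of "Suc p" k]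
  by (auto simp: singular_face_def simplex_map_def fun_eq_iff)

text \<open>Taking faces commutes with composing by f. Being a cochain map, the pullback preserves
  cocycles and coboundaries and so descends to cohomology.\<close>

lemma coboundary_pullback:
  assumes "continuous_map X Y f"
  shows "coboundary p X (cochain_pullback p X f c) =
         cochain_pullback (Suc p) X f (coboundary p Y c)"
proof
  fix \<sigma>
  show "coboundary p X (cochain_pullback p X f c) \<sigma> =
        cochain_pullback (Suc p) X f (coboundary p Y c) \<sigma>"
  proof (cases "singular_simplex (Suc p) X \<sigma>")
    case True
    then show ?thesis
      using singular_simplex_simplex_map [OF True assms]
      by (auto simp: coboundary_def cochain_pullback_def singular_simplex_face
          singular_face_simplex_map_eq simp del: sum.atMost_Suc intro!: sum.cong)
  qed (simp add: coboundary_def cochain_pullback_def)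
qed

lemma cocycle_set_pullback:
  assumes "continuous_map X Y f" and "c \<in> cocycle_set p Y"
  shows "cochain_pullback p X f c \<in> cocycle_set p X"
  using assms by (simp add: cocycle_set_def cochain_pullback_mem coboundary_pullback)

lemma coboundary_set_pullback:
  assumes "continuous_map X Y f" and "b \<in> coboundary_set p Y"
  shows "cochain_pullback p X f b \<in> coboundary_set p X"
proof (cases p)
  case (Suc q)
  then obtain c where "b = coboundary q Y c"
    using assms(2) by auto
  then show ?thesis
    by (simp add: Suc cochain_pullback_mem flip: coboundary_pullback [OF assms(1)])
qed (use assms(2) in simp)

section \<open>Pullback of cohomology classes\<close>

lemma cohomology_pullback_class:
  assumes "continuous_map X Y f"
  shows "cohomology_pullback p X f (cohomology_class p Y c) =
         cohomology_class p X (cochain_pullback p X f c)"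
proof -
  \<comment> \<open>Representatives differ by a coboundary, whose pullback is again a coboundary, so
    all the sets in the union coincide.\<close>
  have "cohomology_class p X (cochain_pullback p X f a) =
        cohomology_class p X (cochain_pullback p X f c)" if "a \<in> cohomology_class p Y c" for a
    using that coboundary_set_pullback [OF assms]
    by (auto simp: mem_cohomology_class cochain_pullback_add cohomology_class_add_coboundary)
  \<comment> \<open>The union has to be taken over a non-empty set in order to equal this common
    class.\<close>
  moreover have "c \<in> cohomology_class p Y c"
    using coboundary_set_zero by (fastforce simp: mem_cohomology_class)
  ultimately show ?thesis
    unfolding cohomology_pullback_def by blast
qed

text \<open>The inner pullback is a union over the members of K, so the formula for a single class
  can be used member by member. Continuity is asked of f alone, so that g can be
  \<open>cech_map d\<close> later.\<close>

lemma cohomology_pullback_compose: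
  assumes "continuous_map X Y f"
  shows "cohomology_pullback p X f (cohomology_pullback p Y g K) = cohomology_pullback p X (g \<circ> f) K"
proof -
  have "cohomology_pullback p X f (cohomology_pullback p Y g K) =
        (\<Union>c\<in>K. cohomology_pullback p X f (cohomology_class p Y (cochain_pullback p Y g c)))"
    by (auto simp: cohomology_pullback_def)
  also have "\<dots> = cohomology_pullback p X (g \<circ> f) K"
    by (simp add: cohomology_pullback_class [OF assms] cochain_pullback_compose [OF assms]
        cohomology_pullback_def [of _ _ "g \<circ> f"])
  finally show ?thesis .
qed

lemma cohomology_pullback_one:
  assumes "continuous_map X Y f"
  shows "cohomology_pullback p X f \<one>\<^bsub>cohomology_group p Y\<^esub> = \<one>\<^bsub>cohomology_group p X\<^esub>"
  using cohomology_pullback_class [OF assms, of p "\<lambda>\<sigma>. 0"]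
  by (simp add: one_cohomology_group cohomology_class_zero)

lemma cohomology_pullback_hom:
  assumes "continuous_map X Y f"
  shows "cohomology_pullback p X f \<in> hom (cohomology_group p Y) (cohomology_group p X)"
  by (rule homI)
    (auto simp: carrier_cohomology_group mult_cohomology_class cohomology_pullback_class [OF assms]
      cochain_pullback_add cocycle_set_pullback [OF assms])

section \<open>Total cohomology\<close>

lemma total_pullback_hom:
  assumes "continuous_map X Y f"
  shows "total_pullback X f \<in> hom (total_cohomology Y) (total_cohomology X)"
proof (rule homI)
  fix h
  assume "h \<in> carrier (total_cohomology Y)"
  then have h: "\<And>i. h i \<in> carrier (cohomology_group i Y)"
    and fin: "finite {i. h i \<noteq> \<one>\<^bsub>cohomology_group i Y\<^esub>}"
    by (auto simp: total_cohomology_def carrier_sum_group group_cohomology_group)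
  \<comment> \<open>Elements of the direct sum have finite support; a degree where h is trivial
    stays trivial, so the support can only shrink.\<close>
  have "finite {i. total_pullback X f h i \<noteq> \<one>\<^bsub>cohomology_group i X\<^esub>}"
    by (rule finite_subset [OF _ fin])
      (auto simp: total_pullback_def cohomology_pullback_one [OF assms])
  then show "total_pullback X f h \<in> carrier (total_cohomology X)"
    using h hom_carrier [OF cohomology_pullback_hom [OF assms]]
    by (auto simp: total_cohomology_def carrier_sum_group group_cohomology_group total_pullback_def)
next
  fix h h'
  assume "h \<in> carrier (total_cohomology Y)" "h' \<in> carrier (total_cohomology Y)"
  then show "total_pullback X f (h \<otimes>\<^bsub>total_cohomology Y\<^esub> h') =
      total_pullback X f h \<otimes>\<^bsub>total_cohomology X\<^esub> total_pullback X f h'"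
    by (auto simp: total_cohomology_def carrier_sum_group group_cohomology_group total_pullback_def
        PiE_iff hom_mult [OF cohomology_pullback_hom [OF assms]])
qed

lemma total_pullback_compose:
  assumes "continuous_map X Y f"
  shows "total_pullback X f (total_pullback Y g h) = total_pullback X (g \<circ> f) h"
  by (simp add: total_pullback_def cohomology_pullback_compose [OF assms])

lemma total_pullback_in_degree:
  assumes "continuous_map X Y f"
  shows "total_pullback X f (in_degree i Y K) = in_degree i X (cohomology_pullback i X f K)"
  by (auto simp: total_pullback_def in_degree_def fun_eq_iff cohomology_pullback_one [OF assms])

section \<open>Thickenings\<close>

text \<open>Scaling the matrix by \<gamma> turns this function into the product norm, from which the
  triangle inequality is inherited.\<close>

lemma gamma_norm_eq: "gamma_norm \<gamma> (x, A) = norm (x, \<gamma> *\<^sub>R A)"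
  by (simp add: gamma_norm_def norm_Pair power_mult_distrib)

lemma gamma_norm_nonneg: "0 \<le> gamma_norm \<gamma> e"
  by (cases e) (simp add: gamma_norm_eq)

lemma gamma_norm_triangle: "gamma_norm \<gamma> (e + e') \<le> gamma_norm \<gamma> e + gamma_norm \<gamma> e'"
proof (cases e, cases e')
  fix x A x' A'
  assume "e = (x, A)" "e' = (x', A')"
  then show ?thesis
    using norm_triangle_ineq [of "(x, \<gamma> *\<^sub>R A)" "(x', \<gamma> *\<^sub>R A')"]
    by (simp add: gamma_norm_eq scaleR_add_right)
qed

lemma gamma_norm_minus_commute: "gamma_norm \<gamma> (e - e') = gamma_norm \<gamma> (e' - e)"
  by (cases e, cases e') (simp add: gamma_norm_def norm_minus_commute)

text \<open>Allows the inclusion of thickenings to be applied with X and Y exchanged.\<close>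

lemma hausdorff_distance_commute: "hausdorff_distance \<gamma> X Y = hausdorff_distance \<gamma> Y X"
  unfolding hausdorff_distance_def by (simp add: max.commute gamma_norm_minus_commute)

lemma thickening_mono: "s \<le> t \<Longrightarrow> thickening \<gamma> X s \<subseteq> thickening \<gamma> X t"
  by (auto simp: thickening_def)

text \<open>Infima need not be attained, hence a slack \<eta>: one half goes into choosing x near e,
  the other into choosing y near x. The inequality s + \<epsilon> \<le> t lets the lemma be applied
  directly to s = t - \<epsilon>.\<close>

lemma thickening_subset:
  assumes "X \<noteq> {}" and "\<epsilon> \<ge> 0" and dist: "hausdorff_distance \<gamma> X Y \<le> ennreal \<epsilon>"
    and "s + \<epsilon> \<le> t"
  shows "thickening \<gamma> X s \<subseteq> thickening \<gamma> Y t"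
proof
  fix e
  assume "e \<in> thickening \<gamma> X s"
  then have e: "(INF x\<in>X. gamma_norm \<gamma> (e - x)) \<le> s"
    by (simp add: thickening_def)
  \<comment> \<open>Lower bounds are what give infima of real sets their usual order
    properties.\<close>
  have bdd: "bdd_below ((\<lambda>y. gamma_norm \<gamma> (e - y)) ` S)" for S
    by (rule bdd_belowI2 [of _ 0]) (rule gamma_norm_nonneg)
  have "(INF y\<in>Y. gamma_norm \<gamma> (e - y)) \<le> t + \<eta>" if "\<eta> > 0" for \<eta>
  proof -
    have "(INF x\<in>X. gamma_norm \<gamma> (e - x)) < s + \<eta> / 2"
      using e that by linarith
    then obtain x where "x \<in> X" and x: "gamma_norm \<gamma> (e - x) < s + \<eta> / 2"
      using cINF_less_iff [OF \<open>X \<noteq> {}\<close> bdd] by blast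
    have "(INF y\<in>Y. ennreal (gamma_norm \<gamma> (x - y))) \<le>
          (SUP x\<in>X. INF y\<in>Y. ennreal (gamma_norm \<gamma> (x - y)))"
      using \<open>x \<in> X\<close> by (rule SUP_upper)
    also have "\<dots> \<le> ennreal \<epsilon>"
      using dist by (simp add: hausdorff_distance_def)
    also have "ennreal \<epsilon> < ennreal (\<epsilon> + \<eta> / 2)"
      using \<open>\<epsilon> \<ge> 0\<close> that by (simp add: ennreal_less_iff)
    \<comment> \<open>In \<open>ennreal\<close> the infimum over an empty set is infinite, so the
      strict bound also supplies a point of Y.\<close>
    finally obtain y where "y \<in> Y" and y: "gamma_norm \<gamma> (x - y) < \<epsilon> + \<eta> / 2"
      by (auto simp: INF_less_iff ennreal_less_iff gamma_norm_nonneg)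
    have "(INF y\<in>Y. gamma_norm \<gamma> (e - y)) \<le> gamma_norm \<gamma> (e - y)"
      using \<open>y \<in> Y\<close> by (rule cINF_lower [OF bdd])
    also have "\<dots> \<le> gamma_norm \<gamma> (e - x) + gamma_norm \<gamma> (x - y)"
      using gamma_norm_triangle [of \<gamma> "e - x" "x - y"] by simp
    finally show ?thesis
      using x y \<open>s + \<epsilon> \<le> t\<close> by simp
  qed
  then show "e \<in> thickening \<gamma> Y t"
    by (simp add: thickening_def field_le_epsilon)
qed

lemma continuous_map_cech_id:
  "thickening \<gamma> X s \<subseteq> thickening \<gamma> Y t \<Longrightarrow> continuous_map (cech_space \<gamma> X s) (cech_space \<gamma> Y t) id"
  by (auto simp: cech_space_def)

text \<open>Both persistent classes are pulled back along the one function
  \<open>cech_map d\<close>, and \<open>cech_map d \<circ> id\<close> is that same function; only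
  its domain changes.\<close>

lemma total_pullback_stiefel_whitney:
  assumes "thickening \<gamma> X s \<subseteq> thickening \<gamma> Y t"
  shows "total_pullback (cech_space \<gamma> X s) id (persistent_stiefel_whitney w \<gamma> d Y i t) =
         persistent_stiefel_whitney w \<gamma> d X i s"
  using continuous_map_cech_id [OF assms]
  by (simp add: persistent_stiefel_whitney_def total_pullback_in_degree cohomology_pullback_compose)

theorem corollary3p4:
  fixes X Y :: "((real^'n) \<times> (real^'m^'m)) set"
    and w :: "(real^'m^'m, (real^'m^'m) \<times> (real^'m)) vector_bundle \<Rightarrow> nat \<Rightarrow> (real^'m^'m) cochain set"
    and d :: nat and \<gamma> \<epsilon> :: real
  assumes "stiefel_whitney_classes w"
    and "1 \<le> d" and "d \<le> CARD('m) - 1"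
    and "\<gamma> > 0" and "\<epsilon> \<ge> 0"
    and "X \<noteq> {}" and "Y \<noteq> {}"
    and "t_max \<gamma> d X > 0" and "t_max \<gamma> d Y > 0"
    and "hausdorff_distance \<gamma> X Y \<le> ennreal \<epsilon>"
  shows "\<exists>\<phi> \<psi>.
    interleaving \<epsilon>
      (cech_index \<gamma> d X) (cech_cohomology \<gamma> X) (cech_restriction \<gamma> X)
      (cech_index \<gamma> d Y) (cech_cohomology \<gamma> Y) (cech_restriction \<gamma> Y) \<phi> \<psi> \<and>
    (\<forall>i\<in>{1..d}.
      (\<forall>t \<in> (\<lambda>t. t + \<epsilon>) ` cech_index \<gamma> d X \<inter> cech_index \<gamma> d Y.
         \<phi> t (persistent_stiefel_whitney w \<gamma> d Y i t) =
           persistent_stiefel_whitney w \<gamma> d X i (t - \<epsilon>)) \<and>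
      (\<forall>s \<in> (\<lambda>t. t + \<epsilon>) ` cech_index \<gamma> d Y \<inter> cech_index \<gamma> d X.
         \<psi> s (persistent_stiefel_whitney w \<gamma> d X i s) =
           persistent_stiefel_whitney w \<gamma> d Y i (s - \<epsilon>)))"
proof -
  let ?\<phi> = "\<lambda>t. total_pullback (cech_space \<gamma> X (t - \<epsilon>)) id"
  let ?\<psi> = "\<lambda>t. total_pullback (cech_space \<gamma> Y (t - \<epsilon>)) id"
  note comp = total_pullback_compose [OF continuous_map_cech_id]
  have XY: "thickening \<gamma> X s \<subseteq> thickening \<gamma> Y t" if "s + \<epsilon> \<le> t" for s t
    using assms that by (intro thickening_subset)
  have YX: "thickening \<gamma> Y s \<subseteq> thickening \<gamma> X t" if "s + \<epsilon> \<le> t" for s t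
    using assms that by (intro thickening_subset) (simp_all add: hausdorff_distance_commute)
  have "interleaving \<epsilon>
      (cech_index \<gamma> d X) (cech_cohomology \<gamma> X) (cech_restriction \<gamma> X)
      (cech_index \<gamma> d Y) (cech_cohomology \<gamma> Y) (cech_restriction \<gamma> Y) ?\<phi> ?\<psi>"
    unfolding interleaving_def Let_def cech_restriction_def cech_cohomology_def
    \<comment> \<open>After \<open>comp\<close>, both sides of each identity are pullbacks along
      \<open>id\<close> to the same thickening: of index s - \<epsilon> for compatibility with
      restrictions, and of index t - 2 * \<epsilon> for the two round trips.\<close>
    by (auto simp: comp XY YX thickening_mono
        intro!: total_pullback_hom continuous_map_cech_id XY YX)
  moreover have "?\<phi> t (persistent_stiefel_whitney w \<gamma> d Y i t) =
      persistent_stiefel_whitney w \<gamma> d X i (t - \<epsilon>)" for i t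
    by (simp add: total_pullback_stiefel_whitney [OF XY])
  moreover have "?\<psi> t (persistent_stiefel_whitney w \<gamma> d X i t) =
      persistent_stiefel_whitney w \<gamma> d Y i (t - \<epsilon>)" for i t
    by (simp add: total_pullback_stiefel_whitney [OF YX])
  ultimately show ?thesis
    by blast
qed

end
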